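(* The $WENO$-6 subdivision scheme $S_{weno}$ is uniformly convergent and, for any initial sequence $f\in l^\infty(\mathbb{Z})$, the limit function $S_{weno}^\infty(f)$ belongs to $C^{\alpha^-}$ with $\alpha=-\log_2\left(\tfrac34\right)$.
   Context: $l^\infty(\mathbb{Z})$ is the space of bounded real sequences indexed by $\mathbb{Z}$ with the sup norm. For a sequence $f$, $df_n=f_{n+1}-f_n$ and $Df_n=f_{n+1}-2f_n+f_{n-1}$. The $WENO$-6 scheme is the interpolatory scheme given by $S_{weno}(f)_{2n}=f_n$ and $$S_{weno}(f)_{2n+1}=\frac{f_n+f_{n+1}}{2}+\frac{\alpha_0}{16}Df_{n+2}-\frac{3\alpha_0+\alpha_1}{16}Df_{n+1}-\frac{\alpha_1+3\alpha_2}{16}Df_n+\frac{\alpha_2}{16}Df_{n-1},$$ where the coefficients $\alpha_i$ ($i=0,1,2$) depend on $n$ and on the data through $df$, and are given by $$\alpha_i=\frac{a_i}{a_0+a_1+a_2},\qquad a_i=\frac{d_i}{(\epsilon+b_i)^2},$$ with fixed constants $d_i>0$, $\epsilon>0$, and with $b_i=b_i(df)_n\ge 0$ smoothness indicators that are functions of the first differences $df$. In particular $\alpha_i\ge0$ and $\alpha_0+\alpha_1+\alpha_2=1$. A subdivision scheme $T$ is uniformly convergent if for every $f\in l^\infty(\mathbb{Z})$ there is a continuous function $f^\infty:\mathbb{R}\to\mathbb{R}$ with $\lim_{j\to+\infty}\sup_{n\in\mathbb{Z}}|T^j(f)_n-f^\infty(2^{-j}n)|=0$; one writes $f^\infty=T^\infty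 f$ (the limit function). For $0<\alpha\le1$, $C^{\alpha^-}$ is the set of continuous bounded functions $f:\mathbb{R}\to\mathbb{R}$ such that for every $\alpha'<\alpha$ (with $\alpha'>0$) there is $C>0$ with $|f(x)-f(y)|\le C|x-y|^{\alpha'}$ for all $x,y\in\mathbb{R}$. *)

theory Defs
  imports "HOL-Analysis.Analysis"
begin

definition linf :: "(int \<Rightarrow> real) set" where
  "linf = {f. bounded (range f)}"

definition fdiff :: "(int \<Rightarrow> real) \<Rightarrow> int \<Rightarrow> real" where
  "fdiff f n = f (n + 1) - f n"

definition sdiff :: "(int \<Rightarrow> real) \<Rightarrow> int \<Rightarrow> real" where
  "sdiff f n = f (n + 1) - 2 * f n + f (n - 1)"

(* The smoothness indicators are an arbitrary b: the number b i g n is b_i(g)_n, where g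
   is the sequence of first differences. Only the indices i = 0, 1, 2 are used. *)

definition weno_raw ::
  "(nat \<Rightarrow> real) \<Rightarrow> real \<Rightarrow> (nat \<Rightarrow> (int \<Rightarrow> real) \<Rightarrow> int \<Rightarrow> real)
    \<Rightarrow> nat \<Rightarrow> (int \<Rightarrow> real) \<Rightarrow> int \<Rightarrow> real" where
  "weno_raw d \<epsilon> b i g n = d i / (\<epsilon> + b i g n)\<^sup>2"

definition weno_weight ::
  "(nat \<Rightarrow> real) \<Rightarrow> real \<Rightarrow> (nat \<Rightarrow> (int \<Rightarrow> real) \<Rightarrow> int \<Rightarrow> real)
    \<Rightarrow> nat \<Rightarrow> (int \<Rightarrow> real) \<Rightarrow> int \<Rightarrow> real" where
  "weno_weight d \<epsilon> b i g n =
     weno_raw d \<epsilon> b i g n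
       / (weno_raw d \<epsilon> b 0 g n + weno_raw d \<epsilon> b 1 g n + weno_raw d \<epsilon> b 2 g n)"

(* On int, div rounds towards minus infinity, so m = 2 * (m div 2) or m = 2 * (m div 2) + 1
   also for negative m. *)

definition weno6 ::
  "(nat \<Rightarrow> real) \<Rightarrow> real \<Rightarrow> (nat \<Rightarrow> (int \<Rightarrow> real) \<Rightarrow> int \<Rightarrow> real)
    \<Rightarrow> (int \<Rightarrow> real) \<Rightarrow> int \<Rightarrow> real" where
  "weno6 d \<epsilon> b f m =
     (let n = m div 2;
          \<alpha> = (\<lambda>i. weno_weight d \<epsilon> b i (fdiff f) n)
      in if even m then f n
         else (f n + f (n + 1)) / 2
              + \<alpha> 0 / 16 * sdiff f (n + 2)
              - (3 * \<alpha> 0 + \<alpha> 1) / 16 * sdiff f (n + 1)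
              - (\<alpha> 1 + 3 * \<alpha> 2) / 16 * sdiff f n
              + \<alpha> 2 / 16 * sdiff f (n - 1))"

(* The supremum is taken in ereal because Sup on real is unspecified for unbounded sets. *)

definition is_limit_function ::
  "((int \<Rightarrow> real) \<Rightarrow> (int \<Rightarrow> real)) \<Rightarrow> (int \<Rightarrow> real) \<Rightarrow> (real \<Rightarrow> real) \<Rightarrow> bool" where
  "is_limit_function T f g \<longleftrightarrow>
     continuous_on UNIV g \<and>
     (\<lambda>j. SUP n. ereal \<bar>(T ^^ j) f n - g (of_int n / 2 ^ j)\<bar>) \<longlonglongrightarrow> 0"

definition uniformly_convergent_scheme ::
  "((int \<Rightarrow> real) \<Rightarrow> (int \<Rightarrow> real)) \<Rightarrow> bool" where
  "uniformly_convergent_scheme T \<longleftrightarrow> (\<forall>f\<in>linf. \<exists>g. is_limit_function T f g)"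

lemma is_limit_function_unique:
  assumes "is_limit_function T f g" "is_limit_function T f h"
  shows "g = h"
proof
  fix x :: real
  define p where "p = (\<lambda>j::nat. \<lfloor>2 ^ j * x\<rfloor>)"
  define y where "y = (\<lambda>j::nat. real_of_int (p j) / 2 ^ j)"
  have "\<bar>y j - x\<bar> \<le> (1 / 2) ^ j" for j
  proof -
    have "\<bar>real_of_int (p j) - 2 ^ j * x\<bar> \<le> 1"
      unfolding p_def by linarith
    then have "\<bar>real_of_int (p j) - 2 ^ j * x\<bar> / 2 ^ j \<le> 1 / 2 ^ j"
      by (simp add: divide_right_mono)
    moreover have "y j - x = (real_of_int (p j) - 2 ^ j * x) / 2 ^ j"
      unfolding y_def by (simp add: field_simps)
    then have "\<bar>real_of_int (p j) - 2 ^ j * x\<bar> / 2 ^ j = \<bar>y j - x\<bar>"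
      by simp
    ultimately show ?thesis
      by (simp add: power_one_over)
  qed
  then have "(\<lambda>j. y j - x) \<longlonglongrightarrow> 0"
    by (intro Lim_null_comparison[OF _ LIMSEQ_power_zero[of "1 / 2 :: real"]] always_eventually)
      auto
  then have y: "y \<longlonglongrightarrow> x"
    using LIM_zero_iff by blast
  have *: "(\<lambda>j. (T ^^ j) f (p j)) \<longlonglongrightarrow> k x" if k: "is_limit_function T f k" for k
  proof -
    have "isCont k x"
      using k by (simp add: is_limit_function_def continuous_on_eq_continuous_at)
    then have ky: "(\<lambda>j. k (y j)) \<longlonglongrightarrow> k x"
      using y by (rule isCont_tendsto_compose)
    have "(\<lambda>j. ereal \<bar>(T ^^ j) f (p j) - k (y j)\<bar>) \<longlonglongrightarrow> 0"
    proof (rule tendsto_sandwich[OF always_eventually always_eventually tendsto_const])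
      show "(\<lambda>j. SUP n. ereal \<bar>(T ^^ j) f n - k (of_int n / 2 ^ j)\<bar>) \<longlonglongrightarrow> 0"
        using k by (simp add: is_limit_function_def)
    qed (auto simp: y_def intro!: SUP_upper2)
    then have "(\<lambda>j. (T ^^ j) f (p j) - k (y j)) \<longlonglongrightarrow> 0"
      by (simp add: zero_ereal_def tendsto_rabs_zero_iff)
    from tendsto_add[OF this ky] show ?thesis
      by simp
  qed
  show "g x = h x"
    using LIMSEQ_unique[OF *[OF assms(1)] *[OF assms(2)]] .
qed

definition limit_function ::
  "((int \<Rightarrow> real) \<Rightarrow> (int \<Rightarrow> real)) \<Rightarrow> (int \<Rightarrow> real) \<Rightarrow> real \<Rightarrow> real" where
  "limit_function T f = (THE g. is_limit_function T f g)"

definition holder_minus :: "real \<Rightarrow> (real \<Rightarrow> real) set" where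
  "holder_minus \<alpha> =
     {g. continuous_on UNIV g \<and> bounded (range g) \<and>
         (\<forall>\<beta>. 0 < \<beta> \<and> \<beta> < \<alpha> \<longrightarrow>
            (\<exists>C>0. \<forall>x y. \<bar>g x - g y\<bar> \<le> C * \<bar>x - y\<bar> powr \<beta>))}"

end

theory Submission
  imports Defs
begin

text \<open>
  Everything rests on the decay of second differences at the rate \<open>3/4\<close> per step, whatever
  the convex weights are.  In the supremum norm a single step contracts by no factor that is
  uniform in the weights.  It does contract by the factor \<open>3/4\<close> in a norm that also measures
  jumps between neighbours, whose balls are the sets of sequences \<open>s\<close> with \<open>\<bar>s n\<bar> \<le> 3 * M\<close> and \<open>\<bar>s (n + 1) - s n\<bar> \<le> 4 * M\<close>
  (\<open>sdiff_box_refine\<close>).  The reason is the following.  Let \<open>e n / 16\<close> be the correction that the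
  scheme adds to the mean of \<open>f n\<close> and \<open>f (n + 1)\<close>.  It is a convex combination of three
  expressions in the second differences \<open>s\<close>; adding \<open>2 * s n\<close> or \<open>2 * s (n + 1)\<close> to any of them gives
  a sum of at most three jumps of \<open>s\<close>, so \<open>2 * s n + e n\<close> and \<open>2 * s (n + 1) + e n\<close> are both at
  most \<open>12 * M\<close> in absolute value.
  Moreover \<open>\<bar>e n\<bar> \<le> 10 * M\<close> (\<open>weno_stencils_hull_bounds\<close>).  The new second differences at odd
  positions are \<open>- e n / 8\<close>; those at even positions, and all jumps, are combinations of \<open>s n\<close> and
  of these sums with total weight small enough.

  First differences satisfy \<open>d' = d / 2 \<plusminus> e / 16\<close>, and since \<open>1/2 < 3/4\<close> they decay like
  \<open>(3/4) ^ j\<close> too (\<open>weno6_power_bounds\<close>).  An interpolatory scheme whose first differences are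
  \<open>O(q ^ j)\<close> converges uniformly, with an error \<open>O(q ^ j)\<close>, to a bounded function that is
  Hoelder continuous of exponent \<open>- log 2 q\<close> at distances up to 1 (\<open>interpolatory_limit\<close>).
\<close>

section \<open>Limits of interpolatory refinement\<close>

text \<open>
  The sequences \<open>F j\<close>, regarded as step functions \<open>x \<mapsto> F j \<lfloor>2 ^ j * x\<rfloor>\<close>, form a uniform Cauchy
  sequence.  Two points at distance at most \<open>2 ^ - j\<close> lie in the same or in neighbouring
  steps of level \<open>j\<close>, which gives the modulus of continuity of the limit.
\<close>

lemma interpolatory_limit:
  fixes F :: "nat \<Rightarrow> int \<Rightarrow> real" and C q :: real
  assumes even: "\<And>j n. F (Suc j) (2 * n) = F j n"
    and diff: "\<And>j n. \<bar>fdiff (F j) n\<bar> \<le> C * q ^ j"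
    and q: "0 < q" "q < 1" and C: "0 < C"
    and bdd: "bounded (range (F 0))"
  obtains K :: real and g :: "real \<Rightarrow> real"
  where "0 < K" "bounded (range g)"
    and "\<And>j n. \<bar>F j n - g (of_int n / 2 ^ j)\<bar> \<le> K * q ^ j"
    and "\<And>x y. \<bar>x - y\<bar> \<le> 1 \<Longrightarrow> \<bar>g x - g y\<bar> \<le> K * \<bar>x - y\<bar> powr (- log 2 q)"
proof -
  define h where "h = (\<lambda>j x. F j \<lfloor>2 ^ j * x :: real\<rfloor>)"
  define c where "c = C / (1 - q)"
  have c0: "0 < c" using C q by (simp add: c_def)
  have Cc: "C \<le> c" using C q by (simp add: c_def field_simps)
  have step: "\<bar>h (Suc j) x - h j x\<bar> \<le> C * q ^ j" for j x
  proof -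
    let ?k = "\<lfloor>2 ^ j * x\<rfloor>"
    have "\<lfloor>2 ^ Suc j * x\<rfloor> = 2 * ?k \<or> \<lfloor>2 ^ Suc j * x\<rfloor> = 2 * ?k + 1"
    proof -
      have "real_of_int ?k \<le> 2 ^ j * x" "2 ^ j * x < real_of_int ?k + 1" by linarith+
      moreover have "2 ^ Suc j * x = 2 * (2 ^ j * x)" by simp
      ultimately show ?thesis by linarith
    qed
    then show ?thesis
    proof
      assume "\<lfloor>2 ^ Suc j * x\<rfloor> = 2 * ?k"
      then show ?thesis using C q even by (simp add: h_def)
    next
      assume "\<lfloor>2 ^ Suc j * x\<rfloor> = 2 * ?k + 1"
      then have "h (Suc j) x - h j x = fdiff (F (Suc j)) (2 * ?k)"
        using even by (simp add: h_def fdiff_def)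
      also have "\<bar>\<dots>\<bar> \<le> C * q ^ Suc j" by (rule diff)
      also have "\<dots> \<le> C * q ^ j"
        using C q by (simp add: mult_left_le_one_le)
      finally show ?thesis .
    qed
  qed
  have summ: "summable (\<lambda>j. h (Suc (j + m)) x - h (j + m) x)" for m x
  proof (rule summable_comparison_test')
    show "summable (\<lambda>j. C * q ^ m * q ^ j)"
      using q by (intro summable_mult summable_geometric) simp
    show "norm (h (Suc (j + m)) x - h (j + m) x) \<le> C * q ^ m * q ^ j" if "j \<ge> 0" for j
      using step[of "j + m" x] by (simp add: power_add mult_ac)
  qed
  define g where "g = (\<lambda>x. h 0 x + (\<Sum>j. h (Suc j) x - h j x))"
  have close: "\<bar>g x - h m x\<bar> \<le> c * q ^ m" for m x
  proof -
    have "(\<Sum>j. h (Suc j) x - h j x)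
        = (\<Sum>j. h (Suc (j + m)) x - h (j + m) x) + (\<Sum>j<m. h (Suc j) x - h j x)"
      using suminf_split_initial_segment[OF summ[of 0 x, simplified], of m] by simp
    moreover have "(\<Sum>j<m. h (Suc j) x - h j x) = h m x - h 0 x"
      by (rule sum_lessThan_telescope)
    ultimately have "g x - h m x = (\<Sum>j. h (Suc (j + m)) x - h (j + m) x)"
      by (simp add: g_def)
    also have "\<bar>\<dots>\<bar> \<le> (\<Sum>j. C * q ^ m * q ^ j)"
    proof -
      have "norm (\<Sum>j. h (Suc (j + m)) x - h (j + m) x) \<le> (\<Sum>j. C * q ^ m * q ^ j)"
      proof (rule norm_suminf_le)
        show "summable (\<lambda>j. C * q ^ m * q ^ j)"
          using q by (intro summable_mult summable_geometric) simp
        show "norm (h (Suc (j + m)) x - h (j + m) x) \<le> C * q ^ m * q ^ j" for j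
          using step[of "j + m" x] by (simp add: power_add mult_ac)
      qed
      then show ?thesis by simp
    qed
    also have "\<dots> = c * q ^ m"
      using q by (simp add: suminf_mult suminf_geometric summable_geometric c_def)
    finally show ?thesis .
  qed
  have local: "\<bar>g x - g y\<bar> \<le> 3 * c * q ^ j" if "x \<le> y" "y - x \<le> 1 / 2 ^ j" for x y j
  proof -
    have "2 ^ j * y \<le> 2 ^ j * x + 1"
      using that(2) by (simp add: field_simps)
    moreover have "2 ^ j * x \<le> 2 ^ j * y" using that(1) by simp
    ultimately have "\<lfloor>2 ^ j * y\<rfloor> = \<lfloor>2 ^ j * x\<rfloor> \<or> \<lfloor>2 ^ j * y\<rfloor> = \<lfloor>2 ^ j * x\<rfloor> + 1"
      by linarith
    then have "\<bar>h j y - h j x\<bar> \<le> C * q ^ j"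
      using diff[of j "\<lfloor>2 ^ j * x\<rfloor>"] C q by (auto simp: h_def fdiff_def)
    also have "\<dots> \<le> c * q ^ j" using Cc q by simp
    finally show ?thesis using close[of x j] close[of y j] by linarith
  qed
  define K where "K = 3 * c / q"
  have K0: "0 < K" using c0 q by (simp add: K_def)
  have cK: "c \<le> K" using c0 q by (simp add: K_def field_simps)
  have holder: "\<bar>g x - g y\<bar> \<le> K * \<bar>x - y\<bar> powr (- log 2 q)" if "x < y" "y - x \<le> 1" for x y
  proof -
    define \<delta> where "\<delta> = y - x"
    have \<delta>: "0 < \<delta>" "\<delta> \<le> 1" using that by (auto simp: \<delta>_def)
    \<comment> \<open>the finest level whose step width is still at least \<open>\<delta>\<close>\<close>
    define j where "j = nat \<lfloor>- log 2 \<delta>\<rfloor>"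
    have l0: "0 \<le> - log 2 \<delta>" using \<delta> by simp
    have j: "real j \<le> - log 2 \<delta>" "- log 2 \<delta> - 1 \<le> real j"
      using l0 unfolding j_def by linarith+
    have "\<delta> = 2 powr log 2 \<delta>" using \<delta> by simp
    also have "\<dots> \<le> 2 powr (- real j)" using j by simp
    also have "\<dots> = 1 / 2 ^ j" by (simp add: powr_minus powr_realpow divide_inverse)
    finally have "\<bar>g x - g y\<bar> \<le> 3 * c * q ^ j"
      using local that unfolding \<delta>_def by simp
    also have "q ^ j = q powr real j" using q by (simp add: powr_realpow)
    also have "\<dots> \<le> q powr (- log 2 \<delta> - 1)"
      using j q by (intro powr_mono') auto
    also have "\<dots> = \<delta> powr (- log 2 q) / q"
    proof -
      have "q powr (- log 2 \<delta>) = \<delta> powr (- log 2 q)"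
        using q \<delta> by (simp add: powr_def log_def)
      moreover have "q powr (- log 2 \<delta> - 1) = q powr (- log 2 \<delta>) / q powr 1"
        by (rule powr_diff)
      ultimately show ?thesis using q by (simp only: powr_one)
    qed
    finally show ?thesis
      using that c0 q by (simp add: K_def \<delta>_def abs_minus_commute mult_ac)
  qed
  show ?thesis
  proof
    show "0 < K" by (rule K0)
    from bdd obtain B where "\<And>n. \<bar>F 0 n\<bar> \<le> B"
      by (auto simp: bounded_iff)
    then have "\<bar>h 0 x\<bar> \<le> B" for x by (simp add: h_def)
    then have "\<bar>g x\<bar> \<le> B + c" for x
      using close[of x 0] by (simp add: abs_le_iff) (smt (verit))
    then show "bounded (range g)" by (auto simp: bounded_iff)
    show "\<bar>F j n - g (of_int n / 2 ^ j)\<bar> \<le> K * q ^ j" for j n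
    proof -
      have "\<bar>F j n - g (of_int n / 2 ^ j)\<bar> \<le> c * q ^ j"
        using close[of "of_int n / 2 ^ j" j] by (simp add: h_def abs_minus_commute)
      also have "\<dots> \<le> K * q ^ j" using cK q by simp
      finally show ?thesis .
    qed
    show "\<bar>g x - g y\<bar> \<le> K * \<bar>x - y\<bar> powr (- log 2 q)" if "\<bar>x - y\<bar> \<le> 1" for x y
    proof (cases x y rule: linorder_cases)
      case less
      then show ?thesis using holder that by simp
    next
      case equal
      then show ?thesis by simp
    next
      case greater
      then show ?thesis using holder[of y x] that by (simp add: abs_minus_commute)
    qed
  qed
qed

lemma holder_minusI:
  fixes g :: "real \<Rightarrow> real"
  assumes K: "0 < K" and \<alpha>: "0 < \<alpha>" and bdd: "bounded (range g)"
    and holder: "\<And>x y. \<bar>x - y\<bar> \<le> 1 \<Longrightarrow> \<bar>g x - g y\<bar> \<le> K * \<bar>x - y\<bar> powr \<alpha>"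
  shows "g \<in> holder_minus \<alpha>"
proof -
  from bdd obtain B where B: "\<And>x. \<bar>g x\<bar> \<le> B"
    by (auto simp: bounded_iff)
  have cont: "isCont g x" for x
  proof -
    have "((\<lambda>y. K * \<bar>y - x\<bar> powr \<alpha>) \<longlongrightarrow> K * \<bar>x - x\<bar> powr \<alpha>) (at x)"
      using \<alpha> by (intro tendsto_intros) auto
    then have "((\<lambda>y. K * \<bar>y - x\<bar> powr \<alpha>) \<longlongrightarrow> 0) (at x)" by simp
    moreover have "\<forall>\<^sub>F y in at x. norm (g y - g x) \<le> K * \<bar>y - x\<bar> powr \<alpha>"
    proof -
      have "\<forall>\<^sub>F y in at x. dist y x < 1"
        by (simp add: eventually_at exI[of _ "1::real"])
      then show ?thesis
        by eventually_elim (use holder in \<open>auto simp: dist_real_def\<close>)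
    qed
    ultimately have "((\<lambda>y. g y - g x) \<longlongrightarrow> 0) (at x)"
      by (rule Lim_null_comparison[rotated])
    then show ?thesis by (simp add: isCont_def LIM_zero_iff)
  qed
  have "\<exists>C>0. \<forall>x y. \<bar>g x - g y\<bar> \<le> C * \<bar>x - y\<bar> powr \<beta>" if \<beta>: "0 < \<beta>" "\<beta> < \<alpha>" for \<beta>
  proof (intro exI[of _ "K + 2 * B"] conjI allI)
    have B0: "0 \<le> B" using B[of 0] by linarith
    then show "0 < K + 2 * B" using K by simp
    fix x y
    show "\<bar>g x - g y\<bar> \<le> (K + 2 * B) * \<bar>x - y\<bar> powr \<beta>"
    proof (cases "\<bar>x - y\<bar> \<le> 1")
      case True
      have "\<bar>g x - g y\<bar> \<le> K * \<bar>x - y\<bar> powr \<alpha>" using holder True .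
      also have "\<dots> \<le> K * \<bar>x - y\<bar> powr \<beta>"
        using True K \<beta> by (intro mult_left_mono powr_mono') auto
      also have "\<dots> \<le> (K + 2 * B) * \<bar>x - y\<bar> powr \<beta>"
        using B0 by (intro mult_right_mono) auto
      finally show ?thesis .
    next
      case False
      have "\<bar>g x - g y\<bar> \<le> (K + 2 * B) * 1" using B[of x] B[of y] K by simp
      also have "\<dots> \<le> (K + 2 * B) * \<bar>x - y\<bar> powr \<beta>"
        using False \<beta> B0 K by (intro mult_left_mono ge_one_powr_ge_zero) auto
      finally show ?thesis .
    qed
  qed
  then show ?thesis
    using cont bdd by (auto simp: holder_minus_def continuous_at_imp_continuous_on)
qed

section \<open>Contraction of second differences\<close>

text \<open>
  The balls of the norm in which every choice of weights contracts.  With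
  the radii in the ratio \<open>3 : 4\<close>, values and jumps both contract by \<open>3/4\<close>.
\<close>

definition sdiff_box :: "real \<Rightarrow> (int \<Rightarrow> real) \<Rightarrow> bool" where
  "sdiff_box M s \<longleftrightarrow> (\<forall>n. \<bar>s n\<bar> \<le> 3 * M \<and> \<bar>s (n + 1) - s n\<bar> \<le> 4 * M)"

text \<open>
  The corrections that the three extreme weight triples add at the midpoint between \<open>n\<close> and
  \<open>n + 1\<close>, multiplied by 16, for second differences \<open>s\<close>.
\<close>

definition weno_stencils :: "(int \<Rightarrow> real) \<Rightarrow> int \<Rightarrow> real set" where
  "weno_stencils s n =
     {s (n + 2) - 3 * s (n + 1), - s (n + 1) - s n, s (n - 1) - 3 * s n}"

lemma abs_add_le_hull:
  fixes B c t :: real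
  assumes "t \<in> convex hull A" and "\<And>a. a \<in> A \<Longrightarrow> \<bar>c + a\<bar> \<le> B"
  shows "\<bar>c + t\<bar> \<le> B"
proof -
  have "{x. \<bar>c + x\<bar> \<le> B} = cball (- c) B"
    by (auto simp: dist_real_def abs_minus_commute)
  then have "convex hull A \<subseteq> {x. \<bar>c + x\<bar> \<le> B}"
    using assms(2) by (intro hull_minimal) auto
  then show ?thesis using assms(1) by auto
qed

text \<open>
  The bound on \<open>t\<close> limits the new second differences at odd positions, \<open>- t / 8\<close>.  The coefficient 2
  in the other two turns every stencil into a sum of jumps of \<open>s\<close>.
\<close>

lemma weno_stencils_hull_bounds:
  assumes box: "sdiff_box M s" and t: "t \<in> convex hull weno_stencils s n"
  shows "\<bar>t\<bar> \<le> 10 * M" "\<bar>2 * s n + t\<bar> \<le> 12 * M" "\<bar>2 * s (n + 1) + t\<bar> \<le> 12 * M"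
proof -
  have val: "\<bar>s n\<bar> \<le> 3 * M" "\<bar>s (n + 1)\<bar> \<le> 3 * M"
    using box by (auto simp: sdiff_box_def)
  have jump: "\<bar>s n - s (n - 1)\<bar> \<le> 4 * M" "\<bar>s (n + 1) - s n\<bar> \<le> 4 * M"
    "\<bar>s (n + 2) - s (n + 1)\<bar> \<le> 4 * M"
  proof -
    have *: "\<bar>s (k + 1) - s k\<bar> \<le> 4 * M" for k using box by (auto simp: sdiff_box_def)
    show "\<bar>s n - s (n - 1)\<bar> \<le> 4 * M" "\<bar>s (n + 1) - s n\<bar> \<le> 4 * M"
      "\<bar>s (n + 2) - s (n + 1)\<bar> \<le> 4 * M"
      using *[of "n - 1"] *[of n] *[of "n + 1"] by (simp_all add: algebra_simps)
  qed
  have cases: "a = s (n + 2) - 3 * s (n + 1) \<or> a = - s (n + 1) - s n \<or> a = s (n - 1) - 3 * s n"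
    if "a \<in> weno_stencils s n" for a
    using that by (auto simp: weno_stencils_def)
  have "\<bar>0 + t\<bar> \<le> 10 * M"
    using t
  proof (rule abs_add_le_hull)
    show "\<bar>0 + a\<bar> \<le> 10 * M" if "a \<in> weno_stencils s n" for a
      using cases[OF that] val jump by (elim disjE) linarith+
  qed
  then show "\<bar>t\<bar> \<le> 10 * M" by simp
  have "\<bar>2 * s n + t\<bar> \<le> 12 * M"
    using t
  proof (rule abs_add_le_hull)
    show "\<bar>2 * s n + a\<bar> \<le> 12 * M" if "a \<in> weno_stencils s n" for a
      using cases[OF that] jump by (elim disjE) linarith+
  qed
  then show "\<bar>2 * s n + t\<bar> \<le> 12 * M" by simp
  have "\<bar>2 * s (n + 1) + t\<bar> \<le> 12 * M"
    using t
  proof (rule abs_add_le_hull)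
    show "\<bar>2 * s (n + 1) + a\<bar> \<le> 12 * M" if "a \<in> weno_stencils s n" for a
      using cases[OF that] jump by (elim disjE) linarith+
  qed
  then show "\<bar>2 * s (n + 1) + t\<bar> \<le> 12 * M" by simp
qed

text \<open>
  Here \<open>e n / 16\<close> is the correction at the midpoint between \<open>n\<close> and \<open>n + 1\<close>, and \<open>s'\<close> are the
  second differences after one step.
\<close>

lemma sdiff_box_refine:
  fixes s s' e :: "int \<Rightarrow> real"
  assumes box: "sdiff_box M s"
    and e: "\<And>n. e n \<in> convex hull weno_stencils s n"
    and s'_even: "\<And>n. s' (2 * n) = s n / 2 + (e n + e (n - 1)) / 16"
    and s'_odd: "\<And>n. s' (2 * n + 1) = - e n / 8"
  shows "sdiff_box (3 / 4 * M) s'"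
  unfolding sdiff_box_def
proof
  fix m :: int
  have val: "\<bar>s n\<bar> \<le> 3 * M" for n using box by (simp add: sdiff_box_def)
  note bounds = weno_stencils_hull_bounds[OF box e]
  show "\<bar>s' m\<bar> \<le> 3 * (3 / 4 * M) \<and> \<bar>s' (m + 1) - s' m\<bar> \<le> 4 * (3 / 4 * M)"
  proof (cases "even m")
    case True
    then obtain n where m: "m = 2 * n" by (elim evenE)
    define u v where "u = 2 * s n + e n" and "v = 2 * s (n - 1 + 1) + e (n - 1)"
    have uv: "\<bar>u\<bar> \<le> 12 * M" "\<bar>v\<bar> \<le> 12 * M"
      unfolding u_def v_def by (rule bounds)+
    have val': "16 * s' m = 4 * s n + u + v"
      using s'_even[of n] by (simp add: m u_def v_def)
    have jump': "16 * (s' (m + 1) - s' m) = - 3 * u - v"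
      using s'_even[of n] s'_odd[of n] by (simp add: m u_def v_def add_divide_distrib)
    have "\<bar>s' m\<bar> \<le> 3 * (3 / 4 * M)" using val' uv val[of n] by linarith
    moreover have "\<bar>s' (m + 1) - s' m\<bar> \<le> 4 * (3 / 4 * M)" using jump' uv by (simp add: abs_le_iff)
    ultimately show ?thesis ..
  next
    case False
    then obtain n where m: "m = 2 * n + 1" by (elim oddE)
    define u v where "u = 2 * s (n + 1) + e n" and "v = 2 * s (n + 1) + e (n + 1)"
    have uv: "\<bar>u\<bar> \<le> 12 * M" "\<bar>v\<bar> \<le> 12 * M"
      unfolding u_def v_def by (rule bounds)+
    have val': "s' m = - e n / 8" using s'_odd m by simp
    have "m + 1 = 2 * (n + 1)" by (simp add: m)
    then have "s' (m + 1) = s (n + 1) / 2 + (e (n + 1) + e n) / 16"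
      using s'_even[of "n + 1"] by (simp only: add_diff_cancel_right')
    then have jump': "16 * (s' (m + 1) - s' m) = 3 * u + v"
      by (simp add: val' u_def v_def)
    have "\<bar>s' m\<bar> \<le> 3 * (3 / 4 * M)" using val' bounds(1)[of n] by linarith
    moreover have "\<bar>s' (m + 1) - s' m\<bar> \<le> 4 * (3 / 4 * M)"
      using jump' uv by (simp add: abs_le_iff)
    ultimately show ?thesis ..
  qed
qed

section \<open>The WENO-6 scheme\<close>

lemma weno_weight_convex:
  assumes "\<And>i. i \<le> 2 \<Longrightarrow> 0 < d i" "0 < \<epsilon>" "\<And>i. i \<le> 2 \<Longrightarrow> 0 \<le> b i g n"
  shows "i \<le> 2 \<Longrightarrow> 0 \<le> weno_weight d \<epsilon> b i g n"
    and "weno_weight d \<epsilon> b 0 g n + weno_weight d \<epsilon> b 1 g n + weno_weight d \<epsilon> b 2 g n = 1"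
proof -
  have raw: "0 < weno_raw d \<epsilon> b i g n" if "i \<le> 2" for i
    using assms(1)[OF that] assms(2) assms(3)[OF that] by (simp add: weno_raw_def add_pos_nonneg)
  note r = raw[of 0, simplified] raw[of 1, simplified] raw[of 2, simplified]
  show "0 \<le> weno_weight d \<epsilon> b i g n" if "i \<le> 2"
    using raw[OF that] r by (auto simp: weno_weight_def)
  show "weno_weight d \<epsilon> b 0 g n + weno_weight d \<epsilon> b 1 g n + weno_weight d \<epsilon> b 2 g n = 1"
    using r by (simp add: weno_weight_def flip: add_divide_distrib)
qed

text \<open>
  The condition \<open>5 * M \<le> 2 * C\<close> comes from the corrections: \<open>\<bar>e n\<bar> / 16 \<le> 5/8 * M\<close>, and
  \<open>C / 2 + 5/8 * M \<le> 3/4 * C\<close> exactly when \<open>5 * M \<le> 2 * C\<close>.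
\<close>

lemma weno6_refine:
  assumes d: "\<And>i. i \<le> 2 \<Longrightarrow> 0 < d i" and \<epsilon>: "0 < \<epsilon>"
    and b: "\<And>i n. i \<le> 2 \<Longrightarrow> 0 \<le> b i (fdiff f) n"
    and box: "sdiff_box M (sdiff f)"
    and diff: "\<And>n. \<bar>fdiff f n\<bar> \<le> C" and CM: "5 * M \<le> 2 * C"
  shows "sdiff_box (3 / 4 * M) (sdiff (weno6 d \<epsilon> b f))"
    and "\<bar>fdiff (weno6 d \<epsilon> b f) n\<bar> \<le> 3 / 4 * C"
proof -
  let ?f = "weno6 d \<epsilon> b f" and ?s = "sdiff f"
  define w where "w = (\<lambda>i n. weno_weight d \<epsilon> b i (fdiff f) n)"
  define e where "e = (\<lambda>n. w 0 n * (?s (n + 2) - 3 * ?s (n + 1)) + w 1 n * (- ?s (n + 1) - ?s n)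
    + w 2 n * (?s (n - 1) - 3 * ?s n))"
  have at_even: "?f (2 * n) = f n" for n by (simp add: weno6_def)
  have at_odd: "?f (2 * n + 1) = (f n + f (n + 1)) / 2 + e n / 16" for n
    by (simp add: weno6_def Let_def e_def w_def field_simps)
  have e: "e n \<in> convex hull weno_stencils ?s n" for n
  proof -
    have "0 \<le> w i n" if "i \<le> 2" for i
      unfolding w_def by (rule weno_weight_convex(1)) (use d \<epsilon> b that in auto)
    moreover have "w 0 n + w 1 n + w 2 n = 1"
      unfolding w_def by (rule weno_weight_convex(2)) (use d \<epsilon> b in auto)
    ultimately show ?thesis
      by (force simp: e_def weno_stencils_def convex_hull_3)
  qed
  have s_even: "sdiff ?f (2 * n) = ?s n / 2 + (e n + e (n - 1)) / 16" for n
  proof -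
    have "2 * n - 1 = 2 * (n - 1) + 1" by simp
    then have "?f (2 * n - 1) = (f (n - 1) + f n) / 2 + e (n - 1) / 16"
      using at_odd[of "n - 1"] by simp
    then show ?thesis
      using at_odd[of n] at_even[of n] by (simp add: sdiff_def field_simps)
  qed
  have s_odd: "sdiff ?f (2 * n + 1) = - e n / 8" for n
  proof -
    have "2 * n + 1 + 1 = 2 * (n + 1)" by simp
    then have "?f (2 * n + 1 + 1) = f (n + 1)" using at_even by metis
    then show ?thesis
      using at_odd[of n] at_even[of n] by (simp add: sdiff_def field_simps)
  qed
  show "sdiff_box (3 / 4 * M) (sdiff ?f)"
    using box e s_even s_odd by (rule sdiff_box_refine)
  show "\<bar>fdiff ?f n\<bar> \<le> 3 / 4 * C"
  proof -
    define k where "k = n div 2"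
    have ek: "\<bar>e k\<bar> \<le> 10 * M" by (rule weno_stencils_hull_bounds(1)[OF box e])
    show ?thesis
    proof (cases "even n")
      case True
      then have n: "n = 2 * k" by (simp add: k_def)
      have "fdiff ?f n = fdiff f k / 2 + e k / 16"
        using at_odd[of k] at_even[of k] by (simp add: n fdiff_def field_simps)
      then show ?thesis using ek diff[of k] CM by linarith
    next
      case False
      then have n: "n = 2 * k + 1" by (simp add: k_def)
      have "n + 1 = 2 * (k + 1)" using n by simp
      then have "?f (n + 1) = f (k + 1)" using at_even by metis
      then have "fdiff ?f n = fdiff f k / 2 - e k / 16"
        using at_odd[of k] by (simp add: n fdiff_def field_simps)
      then show ?thesis using ek diff[of k] CM by linarith
    qed
  qed
qed

lemma weno6_power_bounds:
  assumes d: "\<And>i. i \<le> 2 \<Longrightarrow> 0 < d i" and \<epsilon>: "0 < \<epsilon>"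
    and b: "\<And>i g n. i \<le> 2 \<Longrightarrow> g \<in> linf \<Longrightarrow> 0 \<le> b i g n"
    and box: "sdiff_box M (sdiff f)"
    and diff: "\<And>n. \<bar>fdiff f n\<bar> \<le> C" and CM: "5 * M \<le> 2 * C"
  shows "sdiff_box (M * (3 / 4) ^ j) (sdiff ((weno6 d \<epsilon> b ^^ j) f)) \<and>
    (\<forall>n. \<bar>fdiff ((weno6 d \<epsilon> b ^^ j) f) n\<bar> \<le> C * (3 / 4) ^ j)"
proof (induction j)
  case 0
  then show ?case using box diff by simp
next
  case (Suc j)
  let ?f = "(weno6 d \<epsilon> b ^^ j) f"
  have "fdiff ?f \<in> linf"
    using Suc.IH by (auto simp: linf_def bounded_iff)
  then have b': "0 \<le> b i (fdiff ?f) n" if "i \<le> 2" for i n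
    using b that by blast
  have CM': "5 * (M * (3 / 4) ^ j) \<le> 2 * (C * (3 / 4) ^ j)" using CM by simp
  have IH: "sdiff_box (M * (3 / 4) ^ j) (sdiff ?f)" "\<And>n. \<bar>fdiff ?f n\<bar> \<le> C * (3 / 4) ^ j"
    using Suc.IH by auto
  show ?case
    using weno6_refine[where d = d and b = b, OF _ \<epsilon> b' IH CM'] d by (simp add: mult_ac)
qed

theorem proposition1:
  fixes d :: "nat \<Rightarrow> real" and \<epsilon> :: real
    and b :: "nat \<Rightarrow> (int \<Rightarrow> real) \<Rightarrow> int \<Rightarrow> real"
  assumes "\<And>i. i \<le> 2 \<Longrightarrow> 0 < d i"
    and "0 < \<epsilon>"
    and "\<And>i g n. i \<le> 2 \<Longrightarrow> g \<in> linf \<Longrightarrow> 0 \<le> b i g n"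
  shows "uniformly_convergent_scheme (weno6 d \<epsilon> b) \<and>
    (\<forall>f\<in>linf. limit_function (weno6 d \<epsilon> b) f \<in> holder_minus (- log 2 (3 / 4)))"
proof -
  let ?T = "weno6 d \<epsilon> b"
  have main: "\<exists>g. is_limit_function ?T f g \<and> g \<in> holder_minus (- log 2 (3 / 4))"
    if f: "f \<in> linf" for f
  proof -
    from f obtain B where B: "0 < B" "\<And>n. \<bar>f n\<bar> \<le> B"
      unfolding linf_def bounded_pos by auto
    have s4: "\<bar>sdiff f n\<bar> \<le> 4 * B" for n
      using B(2)[of "n + 1"] B(2)[of n] B(2)[of "n - 1"] unfolding sdiff_def by linarith
    \<comment> \<open>jumps of second differences are at most \<open>8 * B\<close>, hence the box of size \<open>2 * B\<close>; then \<open>5 * B\<close> is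
      the least bound on first differences that \<open>weno6_power_bounds\<close> admits\<close>
    have "\<bar>sdiff f n\<bar> \<le> 3 * (2 * B) \<and> \<bar>sdiff f (n + 1) - sdiff f n\<bar> \<le> 4 * (2 * B)" for n
      using B(1) s4[of n] s4[of "n + 1"] by linarith
    then have box: "sdiff_box (2 * B) (sdiff f)" by (simp add: sdiff_box_def)
    have diff: "\<bar>fdiff f n\<bar> \<le> 5 * B" for n
      using B(1) B(2)[of "n + 1"] B(2)[of n] unfolding fdiff_def by linarith
    have bounds: "\<bar>fdiff ((?T ^^ j) f) n\<bar> \<le> (5 * B) * (3 / 4) ^ j" for j n
      using weno6_power_bounds[where d = d and b = b, OF _ assms(2) _ box diff] assms(1,3)
      by simp
    have even: "(?T ^^ Suc j) f (2 * n) = (?T ^^ j) f n" for j n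
      by (simp add: weno6_def)
    have bdd: "bounded (range ((?T ^^ 0) f))" using f by (simp add: linf_def)
    have q: "(0::real) < 3 / 4" "(3 / 4 :: real) < 1" and C: "0 < 5 * B" using B(1) by simp_all
    obtain K g where K: "0 < K" and g: "bounded (range g)"
      and err: "\<And>j n. \<bar>(?T ^^ j) f n - g (of_int n / 2 ^ j)\<bar> \<le> K * (3 / 4) ^ j"
      and holder: "\<And>x y. \<bar>x - y\<bar> \<le> 1 \<Longrightarrow> \<bar>g x - g y\<bar> \<le> K * \<bar>x - y\<bar> powr (- log 2 (3 / 4))"
      by (rule interpolatory_limit[of "\<lambda>j. (?T ^^ j) f", OF even bounds q C bdd]; rule that)
    have gh: "g \<in> holder_minus (- log 2 (3 / 4))"
      using K _ g holder by (rule holder_minusI) simp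
    have "(\<lambda>j. SUP n. ereal \<bar>(?T ^^ j) f n - g (of_int n / 2 ^ j)\<bar>) \<longlonglongrightarrow> 0"
    proof (rule tendsto_sandwich[OF always_eventually always_eventually tendsto_const])
      show "\<forall>j. 0 \<le> (SUP n. ereal \<bar>(?T ^^ j) f n - g (of_int n / 2 ^ j)\<bar>)"
        by (auto intro!: SUP_upper2)
      show "\<forall>j. (SUP n. ereal \<bar>(?T ^^ j) f n - g (of_int n / 2 ^ j)\<bar>) \<le> ereal (K * (3 / 4) ^ j)"
        using err by (auto intro!: SUP_least)
      have "(\<lambda>j. K * (3 / 4 :: real) ^ j) \<longlonglongrightarrow> K * 0"
        by (intro tendsto_intros LIMSEQ_power_zero) simp
      then show "(\<lambda>j. ereal (K * (3 / 4) ^ j)) \<longlonglongrightarrow> 0"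
        by (simp add: zero_ereal_def)
    qed
    then have "is_limit_function ?T f g"
      using gh by (simp add: is_limit_function_def holder_minus_def)
    then show ?thesis using gh by blast
  qed
  have "limit_function ?T f = g" if "is_limit_function ?T f g" for f g
    unfolding limit_function_def
    using that is_limit_function_unique by (intro the_equality) blast+
  then show ?thesis
    unfolding uniformly_convergent_scheme_def using main by metis
qed

end
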